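(* Let $d\in\mathbb{N}$ and let $q$ be a prime power. Then there exists a constant $C>0$ such that the following holds. Let $a\in\mathbb{F}_q$, let $F,G\in\mathbb{F}_q[y,z]$ be algebraically independent, and let $$P(x,y,z)=ax^d+F(y,z)x+G(y,z).$$ Let $X,Y,Z\subseteq\mathbb{F}_q$ satisfy $|X|,|Y|,|Z|\ge Cq^{2/3}$. Then $$\left|\,|P(X,Y,Z)|-q\,\right|\le K\,\frac{q^3}{|X|\cdot|Y|\cdot|Z|},$$ where $K>0$ is a constant depending only on $\deg(F)$ and $\deg(G)$.
   Context: For sets $X,Y,Z\subseteq\mathbb{F}_q$, $P(X,Y,Z)=\{P(x,y,z):x\in X,\ y\in Y,\ z\in Z\}$. *)

theory Defs
  imports Complex_Main "HOL-Algebra.UnivPoly" "HOL-Number_Theory.Prime_Powers"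
begin

text \<open>
  Finite fields are records with a carrier rather than types of class \<open>field\<close>: a constant that is
  uniform over all finite fields cannot be existentially quantified outside a quantifier over
  types, but it can be quantified outside a quantifier over records. Every finite field is
  isomorphic to one whose carrier is a set of natural numbers, so nothing is lost for an infinite
  carrier type such as \<^typ>\<open>nat\<close>.

  The ring \<open>R[y,z]\<close> is represented as \<open>R[y][z]\<close>; the coefficient of \<open>y\<^sup>i z\<^sup>j\<close> in \<open>F\<close> is the
  \<open>i\<close>-th coefficient of the \<open>j\<close>-th coefficient of \<open>F\<close>.
\<close>

abbreviation bipoly_ring ::
    "('a, 'm) ring_scheme \<Rightarrow> (nat \<Rightarrow> 'a, nat \<Rightarrow> nat \<Rightarrow> 'a) up_ring" where
  "bipoly_ring R \<equiv> UP (UP R)"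

definition bipoly_coeff :: "('a, 'm) ring_scheme \<Rightarrow> (nat \<Rightarrow> nat \<Rightarrow> 'a) \<Rightarrow> nat \<Rightarrow> nat \<Rightarrow> 'a" where
  "bipoly_coeff R F i j = coeff (UP R) (coeff (bipoly_ring R) F j) i"

definition bipoly_const :: "('a, 'm) ring_scheme \<Rightarrow> 'a \<Rightarrow> nat \<Rightarrow> nat \<Rightarrow> 'a" where
  "bipoly_const R c = monom (bipoly_ring R) (monom (UP R) c 0) 0"

text \<open>Total degree; the zero polynomial gets degree 0.\<close>

definition bipoly_deg :: "('a, 'm) ring_scheme \<Rightarrow> (nat \<Rightarrow> nat \<Rightarrow> 'a) \<Rightarrow> nat" where
  "bipoly_deg R F = Max (insert 0 {i + j | i j. bipoly_coeff R F i j \<noteq> \<zero>\<^bsub>R\<^esub>})"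

text \<open>
  The value of \<open>F\<close> at \<open>(u, v)\<close> in an \<open>R\<close>-algebra \<open>S\<close> with structure homomorphism \<open>\<phi>\<close>.
\<close>

definition bipoly_eval ::
    "('a, 'm) ring_scheme \<Rightarrow> ('b, 'n) ring_scheme \<Rightarrow> ('a \<Rightarrow> 'b) \<Rightarrow> 'b \<Rightarrow> 'b \<Rightarrow>
      (nat \<Rightarrow> nat \<Rightarrow> 'a) \<Rightarrow> 'b" where
  "bipoly_eval R S \<phi> u v F = eval (UP R) S (eval R S \<phi> u) v F"

definition algebraically_independent ::
    "('a, 'm) ring_scheme \<Rightarrow> (nat \<Rightarrow> nat \<Rightarrow> 'a) \<Rightarrow> (nat \<Rightarrow> nat \<Rightarrow> 'a) \<Rightarrow> bool" where
  "algebraically_independent R F G \<longleftrightarrow>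
    (\<forall>H \<in> carrier (bipoly_ring R).
       bipoly_eval R (bipoly_ring R) (bipoly_const R) F G H = \<zero>\<^bsub>bipoly_ring R\<^esub> \<longrightarrow>
       H = \<zero>\<^bsub>bipoly_ring R\<^esub>)"

definition P_eval ::
    "('a, 'm) ring_scheme \<Rightarrow> nat \<Rightarrow> 'a \<Rightarrow> (nat \<Rightarrow> nat \<Rightarrow> 'a) \<Rightarrow> (nat \<Rightarrow> nat \<Rightarrow> 'a) \<Rightarrow>
      'a \<Rightarrow> 'a \<Rightarrow> 'a \<Rightarrow> 'a" where
  "P_eval R d a F G x y z =
     a \<otimes>\<^bsub>R\<^esub> x [^]\<^bsub>R\<^esub> d \<oplus>\<^bsub>R\<^esub> bipoly_eval R R (\<lambda>c. c) y z F \<otimes>\<^bsub>R\<^esub> x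
       \<oplus>\<^bsub>R\<^esub> bipoly_eval R R (\<lambda>c. c) y z G"

definition image3 :: "('a \<Rightarrow> 'b \<Rightarrow> 'c \<Rightarrow> 'd) \<Rightarrow> 'a set \<Rightarrow> 'b set \<Rightarrow> 'c set \<Rightarrow> 'd set" where
  "image3 f X Y Z = {f x y z | x y z. x \<in> X \<and> y \<in> Y \<and> z \<in> Z}"

end

theory Submission
  imports Defs "HOL-Algebra.Multiplicative_Group"
begin

text \<open>
  Let \<open>S \<subseteq> Y \<times> Z\<close> and let \<open>f x t\<close> be the number of \<open>s \<in> S\<close> with \<open>P x s = t\<close>. For \<open>s, s' \<in> S\<close> with
  \<open>(F, G) s \<noteq> (F, G) s'\<close> the equation \<open>P x s = P x s'\<close> is linear in \<open>x\<close>, because the term \<open>a x\<^sup>d\<close>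
  cancels, and has at most one solution. So if all fibres of \<open>(F, G)\<close> on \<open>S\<close> have at most \<open>k\<close> elements,
  the sum of \<open>(f x t - card S / q)\<^sup>2\<close> over all \<open>x\<close> and \<open>t\<close> is at most \<open>k q card S\<close>. Since \<open>f x t\<close>
  vanishes for \<open>x \<in> X\<close> and every missed value \<open>t\<close>, at most \<open>k q\<^sup>3 / (card X * card S)\<close> values are
  missed.

  Let \<open>L = deg F + deg G + 1\<close> and \<open>N = L\<^sup>2\<close>. There are more trivariate polynomials \<open>A\<close> of degree at
  most \<open>N\<close> in each variable than polynomials in \<open>y, z\<close> of degree at most \<open>L\<^sup>3\<close> in each, so by the
  pigeonhole principle some \<open>A \<noteq> 0\<close> satisfies \<open>A(F, G, y) = 0\<close>; likewise for \<open>z\<close>. By algebraic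
  independence some coefficient \<open>A\<^sub>k(F, G)\<close> is a nonzero polynomial. Off its zero set, which has
  \<open>O(q)\<close> points, \<open>(F, G)\<close> determines \<open>y\<close> up to \<open>N\<close> choices. Removing these zero sets from \<open>Y \<times> Z\<close>
  leaves fibres of size at most \<open>k = N\<^sup>2\<close>; if \<open>card Y * card Z\<close> is itself \<open>O(q)\<close>, the claim is trivial.
\<close>

section \<open>Univariate polynomials: coefficients, evaluation and roots\<close>

lemma carrier_UP_iff:
  "p \<in> carrier (UP R) \<longleftrightarrow> (\<forall>i. p i \<in> carrier R) \<and> (\<exists>n. \<forall>i>n. p i = \<zero>\<^bsub>R\<^esub>)"
  by (auto simp: UP_def up_def bound_def)

lemma coeff_UP [simp]: "p \<in> carrier (UP R) \<Longrightarrow> coeff (UP R) p i = p i"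
  by (simp add: UP_def)

lemma zero_UP: "\<zero>\<^bsub>UP R\<^esub> = (\<lambda>i. \<zero>\<^bsub>R\<^esub>)"
  by (simp add: UP_def)

lemma cring_UP: "cring R \<Longrightarrow> cring (UP R)"
  by (simp add: UP_cring.UP_cring UP_cring.intro)

lemma UP_cringI: "cring R \<Longrightarrow> UP_cring R"
  by (simp add: UP_cring.intro)

text \<open>Terms beyond the degree vanish, so any bound \<open>n\<close> on the support can replace
  the degree as the range of summation. Polynomials with a common bound then share one index set,
  and \<open>deg\<close> can be avoided below.\<close>

lemma eval_eq_finsum:
  assumes RS: "cring R" "cring S" and h: "h \<in> ring_hom R S" and s: "s \<in> carrier S"
    and p: "p \<in> carrier (UP R)" "\<And>i. i > n \<Longrightarrow> p i = \<zero>\<^bsub>R\<^esub>"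
  shows "eval R S h s p = (\<Oplus>\<^bsub>S\<^esub>i\<in>{..n}. h (p i) \<otimes>\<^bsub>S\<^esub> s [^]\<^bsub>S\<^esub> i)"
proof -
  interpret UP_pre_univ_prop R S h "UP R"
    using UP_pre_univ_propI[OF RS h] .
  have pc: "p i \<in> carrier R" for i using p(1) carrier_UP_iff by metis
  have "deg R p \<le> n"
    using p by (intro deg_aboveI) auto
  moreover have "p i = \<zero>\<^bsub>R\<^esub>" if "i > deg R p" for i
    using deg_aboveD[OF that p(1)] p(1) by simp
  ultimately show ?thesis
    unfolding eval_on_carrier[OF p(1)]
    using s p pc
    by (intro S.add.finprod_mono_neutral_cong_left) (auto simp: Pi_def)
qed

lemma eval_cong:
  assumes "p \<in> carrier (UP R)" "\<And>i. h (p i) = h' (p i)"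
  shows "eval R S h s p = eval R S h' s p"
  using assms by (simp add: eval_def)

lemma eval_in_ring_hom:
  assumes "cring R" "cring S" "h \<in> ring_hom R S" "s \<in> carrier S"
  shows "eval R S h s \<in> ring_hom (UP R) S"
  using UP_pre_univ_prop.eval_ring_hom[OF UP_pre_univ_propI[OF assms(1-3)] assms(4)] .

text \<open>A homomorphism commutes with finite sums and powers. This is what allows a polynomial
  identity between polynomials to be specialised at a point.\<close>

lemma hom_eval:
  assumes RST: "cring R" "cring S" "cring T" and h: "h \<in> ring_hom R S" and g: "g \<in> ring_hom S T"
    and s: "s \<in> carrier S" and p: "p \<in> carrier (UP R)"
  shows "g (eval R S h s p) = eval R T (g \<circ> h) (g s) p"
proof -
  obtain n where n: "\<And>i. i > n \<Longrightarrow> p i = \<zero>\<^bsub>R\<^esub>" using p carrier_UP_iff by metis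
  have pc: "p i \<in> carrier R" for i using p carrier_UP_iff by metis
  interpret H: ring_hom_cring R S h using ring_hom_cringI[OF RST(1,2) h] .
  interpret G: ring_hom_cring S T g using ring_hom_cringI[OF RST(2,3) g] .
  have gh: "g \<circ> h \<in> ring_hom R T" using h g by (rule ring_hom_trans)
  have "eval R S h s p = (\<Oplus>\<^bsub>S\<^esub>i\<in>{..n}. h (p i) \<otimes>\<^bsub>S\<^esub> s [^]\<^bsub>S\<^esub> i)"
    by (rule eval_eq_finsum[OF RST(1,2) h s p]) (rule n)
  then have "g (eval R S h s p) = (\<Oplus>\<^bsub>T\<^esub>i\<in>{..n}. g (h (p i) \<otimes>\<^bsub>S\<^esub> s [^]\<^bsub>S\<^esub> i))"
    using G.hom_finsum[of "\<lambda>i. h (p i) \<otimes>\<^bsub>S\<^esub> s [^]\<^bsub>S\<^esub> i" "{..n}"] s pc by (simp add: Pi_def)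
  also have "\<dots> = (\<Oplus>\<^bsub>T\<^esub>i\<in>{..n}. (g \<circ> h) (p i) \<otimes>\<^bsub>T\<^esub> g s [^]\<^bsub>T\<^esub> i)"
    using s pc by (intro G.S.finsum_cong') (auto simp: Pi_def G.hom_pow)
  also have "\<dots> = eval R T (g \<circ> h) (g s) p"
    by (rule eval_eq_finsum[OF RST(1,3) gh G.hom_closed[OF s] p, symmetric]) (rule n)
  finally show ?thesis .
qed

text \<open>Mapping the coefficients by \<open>h\<close> gives an ordinary polynomial over the field
  \<open>S\<close>, nonzero because of coefficient \<open>k\<close>. It is meant for a polynomial
  ring \<open>R\<close> and a point evaluation \<open>h\<close>; the degree may drop under
  \<open>h\<close>, but \<open>n\<close> remains a bound.\<close>

lemma card_roots_le:
  assumes "cring R" "field S" "finite (carrier S)" and h: "h \<in> ring_hom R S"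
    and p: "p \<in> carrier (UP R)" "\<And>i. i > n \<Longrightarrow> p i = \<zero>\<^bsub>R\<^esub>" and k: "h (p k) \<noteq> \<zero>\<^bsub>S\<^esub>"
  shows "card {s \<in> carrier S. eval R S h s p = \<zero>\<^bsub>S\<^esub>} \<le> n"
proof -
  interpret S: field S by fact
  interpret H: ring_hom_cring R S h using ring_hom_cringI[OF \<open>cring R\<close> S.is_cring h] .
  interpret U: UP_domain S "UP S" by unfold_locales
  have pc: "p i \<in> carrier R" for i using p carrier_UP_iff by metis
  define p' where "p' = (\<lambda>i. h (p i))"
  have p': "p' \<in> carrier (UP S)" "\<And>i. i > n \<Longrightarrow> p' i = \<zero>\<^bsub>S\<^esub>"
    using p(2) pc unfolding carrier_UP_iff p'_def by (auto intro!: exI[of _ n])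
  have "eval R S h s p = eval S S id s p'" if "s \<in> carrier S" for s
    using eval_eq_finsum[OF \<open>cring R\<close> S.is_cring h that p]
      eval_eq_finsum[OF S.is_cring S.is_cring id_ring_hom that p']
    by (simp add: p'_def)
  then have "{s \<in> carrier S. eval R S h s p = \<zero>\<^bsub>S\<^esub>} = {s \<in> carrier S. eval S S id s p' = \<zero>\<^bsub>S\<^esub>}"
    by auto
  moreover have "p' \<noteq> \<zero>\<^bsub>UP S\<^esub>" using k by (auto simp: zero_UP p'_def fun_eq_iff)
  moreover have "deg S p' \<le> n" using p' by (intro U.deg_aboveI) auto
  ultimately show ?thesis using U.roots_bound[OF p'(1) _ assms(3)] by (metis order.trans)
qed

section \<open>Degree boxes and filtrations\<close>

text \<open>The coefficient set \<open>S\<close> is a parameter so that the construction can be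
  iterated, once for each variable, and the cardinality stays an exact power.\<close>

definition up_box :: "('a, 'm) ring_scheme \<Rightarrow> nat \<Rightarrow> 'a set \<Rightarrow> (nat \<Rightarrow> 'a) set" where
  "up_box R n S = {p. (\<forall>i\<le>n. p i \<in> S) \<and> (\<forall>i>n. p i = \<zero>\<^bsub>R\<^esub>)}"

lemma bij_betw_up_box:
  "bij_betw (\<lambda>p. restrict p {..n}) (up_box R n S) ({..n} \<rightarrow>\<^sub>E S)"
  by (rule bij_betw_byWitness[where f' = "\<lambda>f i. if i \<le> n then f i else \<zero>\<^bsub>R\<^esub>"])
     (auto simp: up_box_def fun_eq_iff PiE_def extensional_def)

lemma card_up_box: "card (up_box R n S) = card S ^ Suc n"
  using bij_betw_same_card[OF bij_betw_up_box, of R n S] by (simp add: card_PiE)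

lemma finite_up_box: "finite S \<Longrightarrow> finite (up_box R n S)"
  using bij_betw_finite[OF bij_betw_up_box, of R n S] by (simp add: finite_PiE)

text \<open>An abstract form of a degree bound: an increasing family of additive subgroups that is
  compatible with multiplication. Degree estimates thereby pass from a ring to the polynomial ring
  over it.\<close>

definition filtration :: "('a, 'm) ring_scheme \<Rightarrow> (nat \<Rightarrow> 'a set) \<Rightarrow> bool" where
  "filtration S B \<longleftrightarrow> mono B \<and> \<one>\<^bsub>S\<^esub> \<in> B 0 \<and>
     (\<forall>n. B n \<subseteq> carrier S \<and> \<zero>\<^bsub>S\<^esub> \<in> B n \<and> (\<forall>x\<in>B n. \<ominus>\<^bsub>S\<^esub> x \<in> B n) \<and>
       (\<forall>x\<in>B n. \<forall>y\<in>B n. x \<oplus>\<^bsub>S\<^esub> y \<in> B n)) \<and>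
     (\<forall>m n. \<forall>x\<in>B m. \<forall>y\<in>B n. x \<otimes>\<^bsub>S\<^esub> y \<in> B (m + n))"

lemma filtrationD:
  assumes "filtration S B"
  shows "\<And>m n x. m \<le> n \<Longrightarrow> x \<in> B m \<Longrightarrow> x \<in> B n" "\<one>\<^bsub>S\<^esub> \<in> B 0"
    "\<And>n x. x \<in> B n \<Longrightarrow> x \<in> carrier S" "\<And>n. \<zero>\<^bsub>S\<^esub> \<in> B n"
    "\<And>n x y. x \<in> B n \<Longrightarrow> y \<in> B n \<Longrightarrow> x \<oplus>\<^bsub>S\<^esub> y \<in> B n"
    "\<And>m n x y. x \<in> B m \<Longrightarrow> y \<in> B n \<Longrightarrow> x \<otimes>\<^bsub>S\<^esub> y \<in> B (m + n)"
    "\<And>n x. x \<in> B n \<Longrightarrow> \<ominus>\<^bsub>S\<^esub> x \<in> B n"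
  using assms unfolding filtration_def mono_def by blast+

lemma filtration_finsum:
  assumes "cring S" "filtration S B" "finite A" "\<And>i. i \<in> A \<Longrightarrow> f i \<in> B n"
  shows "(\<Oplus>\<^bsub>S\<^esub>i\<in>A. f i) \<in> B n"
proof -
  interpret cring S by fact
  note F = filtrationD[OF assms(2)]
  show ?thesis using assms(3,4)
  proof (induction A rule: finite_induct)
    case (insert x A)
    then have "f \<in> A \<rightarrow> carrier S" "f x \<in> carrier S" using F(3) by blast+
    then show ?case using insert by (simp add: F(5))
  qed (simp add: F(4))
qed

lemma filtration_pow:
  assumes "cring S" "filtration S B" "s \<in> B t"
  shows "s [^]\<^bsub>S\<^esub> (i::nat) \<in> B (i * t)"
proof -
  interpret cring S by fact
  note F = filtrationD[OF assms(2)]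
  show ?thesis
  proof (induction i)
    case (Suc i)
    then show ?case using F(6)[OF Suc assms(3)] by (simp add: add.commute)
  qed (use F(2) in simp)
qed

lemma filtration_trivial: "cring R \<Longrightarrow> filtration R (\<lambda>n. carrier R)"
  by (auto simp: filtration_def mono_def cring.cring_simprules)

lemma up_box_subset:
  assumes "S \<subseteq> carrier R" "ring R"
  shows "up_box R n S \<subseteq> carrier (UP R)"
proof
  fix p assume p: "p \<in> up_box R n S"
  have "p i \<in> carrier R" for i
    using p assms(1) ring.ring_simprules(2)[OF assms(2)] by (cases "i \<le> n") (auto simp: up_box_def)
  then show "p \<in> carrier (UP R)"
    using p by (auto simp: up_box_def carrier_UP_iff intro!: exI[of _ n])
qed

text \<open>This is the step that adjoins one variable, with the same index bounding the new
  exponent and the coefficients. For products, if \<open>k > m + n\<close> then \<open>i > m\<close>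
  or \<open>k - i > n\<close>, so every term of coefficient \<open>k\<close> has a vanishing
  factor.\<close>

lemma filtration_UP:
  fixes R (structure)
  assumes "cring R" "filtration R B"
  shows "filtration (UP R) (\<lambda>n. up_box R n (B n))"
proof -
  interpret UP_cring R "UP R" using UP_cringI[OF assms(1)] .
  note F = filtrationD[OF assms(2)]
  have all: "p i \<in> B n" if "p \<in> up_box R n (B n)" for p i n
    using that F(4)[of n] unfolding up_box_def by (cases "i \<le> n") auto
  have sub: "up_box R n (B n) \<subseteq> carrier (UP R)" for n
    by (rule up_box_subset) (use F(3) in \<open>auto intro: R.ring_axioms\<close>)
  have add: "p \<oplus>\<^bsub>UP R\<^esub> q \<in> up_box R n (B n)"
    if "p \<in> up_box R n (B n)" "q \<in> up_box R n (B n)" for p q n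
  proof -
    have "p \<in> carrier (UP R)" "q \<in> carrier (UP R)" using that sub by auto
    then have "(p \<oplus>\<^bsub>UP R\<^esub> q) i = p i \<oplus> q i" for i
      by (metis UP_a_closed coeff_add coeff_UP)
    then show ?thesis using that F(5) by (auto simp: up_box_def)
  qed
  have a_inv: "\<ominus>\<^bsub>UP R\<^esub> p \<in> up_box R n (B n)" if "p \<in> up_box R n (B n)" for p n
  proof -
    have "p \<in> carrier (UP R)" using that sub by auto
    then have "(\<ominus>\<^bsub>UP R\<^esub> p) i = \<ominus> p i" for i
      by (metis UP_a_inv_closed coeff_a_inv coeff_UP)
    then show ?thesis using that F(7) by (auto simp: up_box_def)
  qed
  have mult: "p \<otimes>\<^bsub>UP R\<^esub> q \<in> up_box R (m + n) (B (m + n))"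
    if "p \<in> up_box R m (B m)" "q \<in> up_box R n (B n)" for p q m n
  proof -
    have c: "p \<in> carrier (UP R)" "q \<in> carrier (UP R)" using that sub by auto
    have eq: "(p \<otimes>\<^bsub>UP R\<^esub> q) k = (\<Oplus>i\<in>{..k}. p i \<otimes> q (k - i))" for k
      using coeff_mult[OF c, of k] c by simp
    have "(p \<otimes>\<^bsub>UP R\<^esub> q) k \<in> B (m + n)" for k
      unfolding eq by (intro filtration_finsum[OF assms] F(6) all[OF that(1)] all[OF that(2)]) simp
    moreover have "(p \<otimes>\<^bsub>UP R\<^esub> q) k = \<zero>" if k: "k > m + n" for k
    proof -
      have z: "p i \<otimes> q (k - i) = \<zero>" for i
      proof (cases "i > m")
        case True
        then show ?thesis using \<open>p \<in> up_box R m (B m)\<close> F(3)[OF all[OF \<open>q \<in> up_box R n (B n)\<close>]]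
          by (auto simp: up_box_def)
      next
        case False
        then have "k - i > n" using k by simp
        then show ?thesis using \<open>q \<in> up_box R n (B n)\<close> F(3)[OF all[OF \<open>p \<in> up_box R m (B m)\<close>]]
          by (auto simp: up_box_def)
      qed
      show ?thesis unfolding eq z by simp
    qed
    ultimately show ?thesis by (auto simp: up_box_def)
  qed
  have "\<one>\<^bsub>UP R\<^esub> \<in> up_box R 0 (B 0)" "\<And>n. \<zero>\<^bsub>UP R\<^esub> \<in> up_box R n (B n)"
    using F(2,4) by (auto simp: UP_def up_box_def)
  moreover have "mono (\<lambda>n. up_box R n (B n))"
  proof (rule monoI, rule subsetI)
    fix m n :: nat and p assume "m \<le> n" "p \<in> up_box R m (B m)"
    then show "p \<in> up_box R n (B n)"
      using F(1)[OF \<open>m \<le> n\<close> all] by (auto simp: up_box_def)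
  qed
  ultimately show ?thesis using sub add a_inv mult by (simp add: filtration_def)
qed

text \<open>Each term \<open>h (p i)\<close> times the \<open>i\<close>-th power of \<open>s\<close>
  has degree at most \<open>r + i * t\<close>, and \<open>i\<close> is at most
  \<open>n\<close>.\<close>

lemma eval_in_filtration:
  assumes RS: "cring R" "cring S" and h: "h \<in> ring_hom R S" and B: "filtration S B"
    and s: "s \<in> B t" and C: "C \<subseteq> carrier R" "h ` C \<subseteq> B r" and p: "p \<in> up_box R n C"
  shows "eval R S h s p \<in> B (r + n * t)"
proof -
  note F = filtrationD[OF B]
  have "p \<in> carrier (UP R)"
    using up_box_subset[OF C(1)] p cring.axioms(1)[OF RS(1)] by blast
  then have "eval R S h s p = (\<Oplus>\<^bsub>S\<^esub>i\<in>{..n}. h (p i) \<otimes>\<^bsub>S\<^esub> s [^]\<^bsub>S\<^esub> i)"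
    using eval_eq_finsum[OF RS h F(3)[OF s], of p n] p by (auto simp: up_box_def)
  also have "\<dots> \<in> B (r + n * t)"
  proof (rule filtration_finsum[OF RS(2) B])
    fix i assume i: "i \<in> {..n}"
    then have "h (p i) \<in> B r" using p C(2) by (auto simp: up_box_def)
    moreover have "s [^]\<^bsub>S\<^esub> i \<in> B (n * t)"
      by (rule F(1)[OF _ filtration_pow[OF RS(2) B s]]) (use i in simp)
    ultimately show "h (p i) \<otimes>\<^bsub>S\<^esub> s [^]\<^bsub>S\<^esub> i \<in> B (r + n * t)" by (rule F(6))
  qed simp
  finally show ?thesis .
qed

section \<open>Second moment bound for the missed values\<close>

lemma sum_of_bool_image_eq:
  fixes f :: "'b \<Rightarrow> 'c"
  assumes "finite C" "f a \<in> C"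
  shows "(\<Sum>t\<in>C. of_bool (f a = t) * g t) = (g (f a) :: real)"
  using assms by (simp add: of_bool_def if_distrib[of "\<lambda>x. x * _"] cong: if_cong)

text \<open>The function \<open>g\<close> stands for the term \<open>a x^d\<close> and may be
  arbitrary, since it cancels when two values at the same \<open>x\<close> are compared. Points of
  \<open>S\<close> matter only through their values under \<open>\<phi>\<close> and
  \<open>\<psi>\<close>.\<close>

lemma card_missed_values_le:
  fixes R (structure)
  assumes "field R" and fin: "finite (carrier R)" "finite S"
    and \<phi>: "\<And>s. s \<in> S \<Longrightarrow> \<phi> s \<in> carrier R" and \<psi>: "\<And>s. s \<in> S \<Longrightarrow> \<psi> s \<in> carrier R"
    and g: "\<And>x. x \<in> carrier R \<Longrightarrow> g x \<in> carrier R"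
    and fibre: "\<And>s. s \<in> S \<Longrightarrow> card {s' \<in> S. \<phi> s' = \<phi> s \<and> \<psi> s' = \<psi> s} \<le> k"
    and X: "X \<subseteq> carrier R" and T: "T \<subseteq> carrier R"
    and missed: "\<And>x s. x \<in> X \<Longrightarrow> s \<in> S \<Longrightarrow> g x \<oplus>\<^bsub>R\<^esub> \<phi> s \<otimes>\<^bsub>R\<^esub> x \<oplus>\<^bsub>R\<^esub> \<psi> s \<notin> T"
  shows "card X * card T * card S \<le> k * card (carrier R) ^ 3"
proof (cases "S = {}")
  case False
  interpret field R by fact
  let ?C = "carrier R"
  let ?q = "real (card ?C)"
  let ?n = "real (card S)"
  have q: "?q > 0" using fin(1) one_closed by (auto simp: card_gt_0_iff)
  have n: "?n > 0" using False fin(2) by (simp add: card_gt_0_iff)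
  define P where "P x s = g x \<oplus> \<phi> s \<otimes> x \<oplus> \<psi> s" for x s
  define f where "f x t = (\<Sum>s\<in>S. of_bool (P x s = t) :: real)" for x t
  have P: "P x s \<in> ?C" if "x \<in> ?C" "s \<in> S" for x s
    using that \<phi> \<psi> g by (simp add: P_def)
  have sum1: "(\<Sum>t\<in>?C. f x t) = ?n" if "x \<in> ?C" for x
  proof -
    have "(\<Sum>t\<in>?C. f x t) = (\<Sum>s\<in>S. \<Sum>t\<in>?C. of_bool (P x s = t) * 1)"
      unfolding f_def by (subst sum.swap) simp
    also have "\<dots> = (\<Sum>s\<in>S. 1)"
      by (rule sum.cong[OF refl], rule sum_of_bool_image_eq[OF fin(1)]) (use P that in auto)
    finally show ?thesis by simp
  qed
  \<comment> \<open>For fixed \<open>x\<close>, the second moment counts the ordered pairs in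
    \<open>S\<close> whose values collide.\<close>
  have sum2: "(\<Sum>t\<in>?C. (f x t)\<^sup>2) = (\<Sum>s\<in>S. \<Sum>s'\<in>S. of_bool (P x s' = P x s))" if "x \<in> ?C" for x
  proof -
    have "(\<Sum>t\<in>?C. (f x t)\<^sup>2) = (\<Sum>t\<in>?C. \<Sum>s\<in>S. of_bool (P x s = t) * f x t)"
      by (simp add: power2_eq_square f_def sum_distrib_right)
    also have "\<dots> = (\<Sum>s\<in>S. \<Sum>t\<in>?C. of_bool (P x s = t) * f x t)"
      by (rule sum.swap)
    also have "\<dots> = (\<Sum>s\<in>S. f x (P x s))"
      by (rule sum.cong[OF refl], rule sum_of_bool_image_eq[OF fin(1)]) (use P that in auto)
    finally show ?thesis by (simp add: f_def)
  qed
  \<comment> \<open>A pair in one fibre collides for all \<open>q\<close> values of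
    \<open>x\<close>, any other pair for at most one \<open>x\<close>; the right-hand side covers
    both cases.\<close>
  have coll: "(\<Sum>x\<in>?C. of_bool (P x s' = P x s)) \<le> 1 + ?q * of_bool (\<phi> s' = \<phi> s \<and> \<psi> s' = \<psi> s)"
    if s: "s \<in> S" "s' \<in> S" for s s'
  proof (cases "\<phi> s' = \<phi> s \<and> \<psi> s' = \<psi> s")
    case True
    then show ?thesis using sum_bounded_above[of ?C "\<lambda>x. of_bool (P x s' = P x s)" "1::real"] by auto
  next
    case False
    have "x = y" if x: "x \<in> ?C" "P x s' = P x s" and y: "y \<in> ?C" "P y s' = P y s" for x y
    proof -
      have c: "\<phi> s \<in> ?C" "\<phi> s' \<in> ?C" "\<psi> s \<in> ?C" "\<psi> s' \<in> ?C" using s \<phi> \<psi> by auto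
      \<comment> \<open>Subtraction removes \<open>g x\<close> and leaves a linear equation in
        \<open>x\<close>. Its leading coefficient cannot vanish, since then the constant terms would
        agree as well and the two points would share a fibre.\<close>
      have *: "(\<phi> s' \<ominus> \<phi> s) \<otimes> x = \<psi> s \<ominus> \<psi> s'" if "x \<in> ?C" "P x s' = P x s" for x
      proof -
        have "\<phi> s' \<otimes> x \<oplus> \<psi> s' = \<phi> s \<otimes> x \<oplus> \<psi> s"
          using that c g[OF that(1)] by (simp add: P_def a_assoc)
        then have "(\<phi> s' \<otimes> x \<oplus> \<psi> s') \<ominus> \<phi> s \<otimes> x \<ominus> \<psi> s' = (\<phi> s \<otimes> x \<oplus> \<psi> s) \<ominus> \<phi> s \<otimes> x \<ominus> \<psi> s'"
          by simp
        moreover have "(\<phi> s' \<otimes> x \<oplus> \<psi> s') \<ominus> \<phi> s \<otimes> x \<ominus> \<psi> s' = (\<phi> s' \<ominus> \<phi> s) \<otimes> x"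
          using c that(1) by algebra
        moreover have "(\<phi> s \<otimes> x \<oplus> \<psi> s) \<ominus> \<phi> s \<otimes> x \<ominus> \<psi> s' = \<psi> s \<ominus> \<psi> s'"
          using c that(1) by algebra
        ultimately show ?thesis by simp
      qed
      have "\<phi> s' \<ominus> \<phi> s \<noteq> \<zero>"
      proof
        assume zero: "\<phi> s' \<ominus> \<phi> s = \<zero>"
        then have "\<psi> s \<ominus> \<psi> s' = \<zero>" using *[OF x] x(1) by simp
        then show False using zero False c by (metis r_right_minus_eq)
      qed
      then show "x = y" using *[OF x] *[OF y] m_lcancel[of "\<phi> s' \<ominus> \<phi> s" x y] c x y by simp
    qed
    then have "card {x \<in> ?C. P x s' = P x s} \<le> 1"
      using fin(1) by (simp add: card_le_Suc0_iff_eq)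
    then show ?thesis using fin(1) by (simp add: of_bool_def sum.If_cases Int_def False)
  qed
  have E: "(\<Sum>s\<in>S. \<Sum>s'\<in>S. of_bool (\<phi> s' = \<phi> s \<and> \<psi> s' = \<psi> s)) \<le> k * ?n"
  proof -
    have "(\<Sum>s\<in>S. \<Sum>s'\<in>S. of_bool (\<phi> s' = \<phi> s \<and> \<psi> s' = \<psi> s)) \<le> (\<Sum>s\<in>S. real k)"
      by (rule sum_mono) (use fibre fin(2) in \<open>simp add: of_bool_def sum.If_cases Int_def\<close>)
    then show ?thesis by (simp add: mult.commute)
  qed
  have "(\<Sum>x\<in>?C. \<Sum>t\<in>?C. (f x t)\<^sup>2) = (\<Sum>x\<in>?C. \<Sum>s\<in>S. \<Sum>s'\<in>S. of_bool (P x s' = P x s))"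
    using sum2 by simp
  also have "\<dots> = (\<Sum>s\<in>S. \<Sum>x\<in>?C. \<Sum>s'\<in>S. of_bool (P x s' = P x s))"
    by (rule sum.swap)
  also have "\<dots> = (\<Sum>s\<in>S. \<Sum>s'\<in>S. \<Sum>x\<in>?C. of_bool (P x s' = P x s))"
    by (rule sum.cong[OF refl], rule sum.swap)
  also have "\<dots> \<le> (\<Sum>s\<in>S. \<Sum>s'\<in>S. 1 + ?q * of_bool (\<phi> s' = \<phi> s \<and> \<psi> s' = \<psi> s))"
    by (intro sum_mono coll)
  also have "\<dots> = ?n\<^sup>2 + ?q * (\<Sum>s\<in>S. \<Sum>s'\<in>S. of_bool (\<phi> s' = \<phi> s \<and> \<psi> s' = \<psi> s))"
    by (simp add: sum.distrib power2_eq_square flip: sum_distrib_left)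
  also have "\<dots> \<le> ?n\<^sup>2 + ?q * (k * ?n)"
    using E q by (intro add_left_mono mult_left_mono) auto
  finally have moment: "(\<Sum>x\<in>?C. \<Sum>t\<in>?C. (f x t)\<^sup>2) \<le> ?n\<^sup>2 + ?q * (k * ?n)" .
  \<comment> \<open>For each \<open>x\<close> the mean of \<open>f x\<close> over the field is
    \<open>?n / ?q\<close>, so centring lowers the second moment by \<open>?n^2 / ?q\<close>. Over
    all \<open>q\<close> values of \<open>x\<close> this removes exactly the main term of
    \<open>moment\<close>.\<close>
  have "(\<Sum>x\<in>?C. \<Sum>t\<in>?C. (f x t - ?n / ?q)\<^sup>2)
      = (\<Sum>x\<in>?C. (\<Sum>t\<in>?C. (f x t)\<^sup>2) - ?n\<^sup>2 / ?q)"
  proof (rule sum.cong[OF refl])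
    fix x assume x: "x \<in> ?C"
    have "(\<Sum>t\<in>?C. (f x t - ?n / ?q)\<^sup>2)
        = (\<Sum>t\<in>?C. (f x t)\<^sup>2) - 2 * (?n / ?q) * (\<Sum>t\<in>?C. f x t) + ?q * (?n / ?q)\<^sup>2"
      by (simp add: power2_diff sum.distrib sum_subtractf sum_distrib_left sum_divide_distrib algebra_simps)
    then show "(\<Sum>t\<in>?C. (f x t - ?n / ?q)\<^sup>2) = (\<Sum>t\<in>?C. (f x t)\<^sup>2) - ?n\<^sup>2 / ?q"
      using q by (simp add: sum1[OF x] power2_eq_square field_simps)
  qed
  also have "\<dots> = (\<Sum>x\<in>?C. \<Sum>t\<in>?C. (f x t)\<^sup>2) - ?n\<^sup>2"
    using q by (simp add: sum_subtractf)
  also have "\<dots> \<le> ?q * (k * ?n)" using moment by simp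
  finally have var: "(\<Sum>x\<in>?C. \<Sum>t\<in>?C. (f x t - ?n / ?q)\<^sup>2) \<le> ?q * (k * ?n)" .
  have f0: "f x t = 0" if "x \<in> X" "t \<in> T" for x t
    unfolding f_def P_def by (rule sum.neutral) (use missed that in auto)
  \<comment> \<open>On \<open>X\<close> times \<open>T\<close> each deviation equals the mean in
    absolute value; enlarging both ranges to the whole field only adds squares.\<close>
  have "real (card X) * real (card T) * (?n / ?q)\<^sup>2 = (\<Sum>x\<in>X. \<Sum>t\<in>T. (f x t - ?n / ?q)\<^sup>2)"
    using f0 by simp
  also have "\<dots> \<le> (\<Sum>x\<in>X. \<Sum>t\<in>?C. (f x t - ?n / ?q)\<^sup>2)"
    by (intro sum_mono sum_mono2 fin T) auto
  also have "\<dots> \<le> (\<Sum>x\<in>?C. \<Sum>t\<in>?C. (f x t - ?n / ?q)\<^sup>2)"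
    by (intro sum_mono2 fin X sum_nonneg) auto
  also note var
  finally have "(real (card X) * real (card T) * ?n) * ?n \<le> (k * ?q ^ 3) * ?n"
    using q by (simp add: field_simps power2_eq_square power3_eq_cube)
  then have "real (card X) * real (card T) * ?n \<le> k * ?q ^ 3"
    using n by simp
  then show ?thesis by (simp flip: of_nat_mult of_nat_power)
qed simp

section \<open>Bivariate polynomials: degree, evaluation and zeros\<close>

text \<open>The degree is bounded in each variable separately rather than in total, which makes the
  box a full product and its size a simple power of \<open>q\<close>.\<close>

definition bipoly_box :: "('a, 'm) ring_scheme \<Rightarrow> nat \<Rightarrow> (nat \<Rightarrow> nat \<Rightarrow> 'a) set" where
  "bipoly_box R n = up_box (UP R) n (up_box R n (carrier R))"

lemma filtration_bipoly_box: "cring R \<Longrightarrow> filtration (bipoly_ring R) (bipoly_box R)"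
  unfolding bipoly_box_def
  using filtration_UP[OF cring_UP filtration_UP[OF _ filtration_trivial]] by blast

lemma finite_bipoly_box: "finite (carrier R) \<Longrightarrow> finite (bipoly_box R n)"
  by (simp add: bipoly_box_def finite_up_box)

lemma card_bipoly_box: "card (bipoly_box R n) = card (carrier R) ^ (Suc n ^ 2)"
  by (simp only: bipoly_box_def card_up_box power2_eq_square power_mult)

lemma bipoly_in_box:
  assumes F: "F \<in> carrier (bipoly_ring R)"
  shows "F \<in> bipoly_box R (bipoly_deg R F)"
proof -
  let ?D = "{i + j | i j. bipoly_coeff R F i j \<noteq> \<zero>\<^bsub>R\<^esub>}"
  have Fj: "F j \<in> carrier (UP R)" for j using F carrier_UP_iff by metis
  have co: "bipoly_coeff R F i j = F j i" for i j
    using F Fj by (simp add: bipoly_coeff_def)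
  obtain n where n: "\<And>j. j > n \<Longrightarrow> F j = \<zero>\<^bsub>UP R\<^esub>" using F carrier_UP_iff by metis
  obtain b where b: "\<And>i j. i > b j \<Longrightarrow> F j i = \<zero>\<^bsub>R\<^esub>"
    using Fj unfolding carrier_UP_iff by metis
  \<comment> \<open>\<open>Max\<close> is an upper bound only for a finite set, so the support is
    first enclosed in a finite union.\<close>
  have "?D \<subseteq> (\<Union>j\<in>{..n}. (\<lambda>i. i + j) ` {..b j})"
  proof
    fix k assume "k \<in> ?D"
    then obtain i j where ij: "k = i + j" "F j i \<noteq> \<zero>\<^bsub>R\<^esub>" by (auto simp: co)
    then have "j \<le> n" "i \<le> b j"
      using n[of j] b[of j i] by (auto simp: zero_UP not_less[symmetric])
    then show "k \<in> (\<Union>j\<in>{..n}. (\<lambda>i. i + j) ` {..b j})" using ij by auto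
  qed
  then have "finite ?D" by (rule finite_subset) auto
  then have deg: "F j i = \<zero>\<^bsub>R\<^esub>" if "i + j > bipoly_deg R F" for i j
  proof -
    have "i + j \<le> bipoly_deg R F" if "F j i \<noteq> \<zero>\<^bsub>R\<^esub>"
      unfolding bipoly_deg_def using \<open>finite ?D\<close> that by (intro Max_ge) (auto simp: co)
    then show ?thesis using that by linarith
  qed
  show ?thesis
    unfolding bipoly_box_def up_box_def
    using Fj by (auto simp: deg zero_UP carrier_UP_iff)
qed

lemma ring_hom_ident: "(\<lambda>c. c) \<in> ring_hom R R"
  using id_ring_hom by (simp add: id_def)

lemma bipoly_const_ring_hom:
  assumes "cring R" shows "bipoly_const R \<in> ring_hom R (bipoly_ring R)"
proof -
  interpret U: UP_cring R "UP R" using UP_cringI[OF assms] .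
  interpret V: UP_cring "UP R" "UP (UP R)" using UP_cringI[OF cring_UP[OF assms]] .
  show ?thesis using ring_hom_trans[OF U.const_ring_hom V.const_ring_hom]
    by (simp add: bipoly_const_def[abs_def] comp_def)
qed

lemma monom_in_up_box:
  assumes "c \<in> carrier R" "c \<in> C" "\<zero>\<^bsub>R\<^esub> \<in> C" "k \<le> n"
  shows "monom (UP R) c k \<in> up_box R n C"
  using assms by (auto simp: UP_def up_box_def)

lemma bipoly_const_in_box:
  assumes "cring R" "c \<in> carrier R" shows "bipoly_const R c \<in> bipoly_box R 0"
proof -
  interpret U: UP_cring R "UP R" using UP_cringI[OF assms(1)] .
  show ?thesis unfolding bipoly_const_def bipoly_box_def
    using assms(2) by (intro monom_in_up_box U.monom_closed) (auto simp: up_box_def zero_UP)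
qed

lemma bipoly_eval_ring_hom:
  assumes "cring R" "cring S" "\<phi> \<in> ring_hom R S" "u \<in> carrier S" "v \<in> carrier S"
  shows "bipoly_eval R S \<phi> u v \<in> ring_hom (bipoly_ring R) S"
  unfolding bipoly_eval_def[abs_def]
  by (intro eval_in_ring_hom cring_UP assms)

text \<open>Two applications of \<open>hom_eval\<close>, one for each variable. The map
  \<open>\<psi>\<close> is compared with the composition on the carrier alone, so that it can be the
  plain identity.\<close>

lemma hom_bipoly_eval:
  assumes RST: "cring R" "cring S" "cring T" and \<phi>: "\<phi> \<in> ring_hom R S" and g: "g \<in> ring_hom S T"
    and u: "u \<in> carrier S" and v: "v \<in> carrier S" and H: "H \<in> carrier (bipoly_ring R)"
    and \<psi>: "\<And>c. c \<in> carrier R \<Longrightarrow> \<psi> c = g (\<phi> c)"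
  shows "g (bipoly_eval R S \<phi> u v H) = bipoly_eval R T \<psi> (g u) (g v) H"
proof -
  have Hj: "H j \<in> carrier (UP R)" for j using H carrier_UP_iff by metis
  then have Hc: "H j i \<in> carrier R" for i j using carrier_UP_iff by metis
  have "g (bipoly_eval R S \<phi> u v H) = eval (UP R) T (g \<circ> eval R S \<phi> u) (g v) H"
    unfolding bipoly_eval_def
    by (rule hom_eval[OF cring_UP[OF RST(1)] RST(2,3) _ g v H]) (rule eval_in_ring_hom[OF RST(1,2) \<phi> u])
  also have "\<dots> = eval (UP R) T (eval R T \<psi> (g u)) (g v) H"
  proof (rule eval_cong[OF H])
    fix j
    have "(g \<circ> eval R S \<phi> u) (H j) = eval R T (g \<circ> \<phi>) (g u) (H j)"
      using hom_eval[OF RST \<phi> g u Hj] by simp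
    also have "\<dots> = eval R T \<psi> (g u) (H j)"
      by (rule eval_cong[OF Hj]) (use \<psi> Hc in auto)
    finally show "(g \<circ> eval R S \<phi> u) (H j) = eval R T \<psi> (g u) (H j)" .
  qed
  finally show ?thesis by (simp add: bipoly_eval_def)
qed

definition bipoly_Y :: "('a, 'm) ring_scheme \<Rightarrow> nat \<Rightarrow> nat \<Rightarrow> 'a" where
  "bipoly_Y R = monom (bipoly_ring R) (monom (UP R) \<one>\<^bsub>R\<^esub> 1) 0"

definition bipoly_Z :: "('a, 'm) ring_scheme \<Rightarrow> nat \<Rightarrow> nat \<Rightarrow> 'a" where
  "bipoly_Z R = monom (bipoly_ring R) \<one>\<^bsub>UP R\<^esub> 1"

lemma bipoly_vars_in_box:
  assumes "cring R"
  shows "bipoly_Y R \<in> bipoly_box R 1" "bipoly_Z R \<in> bipoly_box R 1"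
proof -
  interpret U: UP_cring R "UP R" using UP_cringI[OF assms] .
  show "bipoly_Y R \<in> bipoly_box R 1"
    unfolding bipoly_Y_def bipoly_box_def
    by (intro monom_in_up_box U.monom_closed) (auto simp: up_box_def zero_UP)
  have "\<one>\<^bsub>UP R\<^esub> \<in> up_box R 1 (carrier R)"
    by (auto simp: UP_def up_box_def)
  then show "bipoly_Z R \<in> bipoly_box R 1"
    unfolding bipoly_Z_def bipoly_box_def
    by (intro monom_in_up_box U.UP_one_closed) (auto simp: up_box_def zero_UP)
qed

lemma bipoly_eval_simps:
  assumes R: "cring R" "cring S" "\<phi> \<in> ring_hom R S" "u \<in> carrier S" "v \<in> carrier S"
  shows "bipoly_eval R S \<phi> u v (bipoly_Y R) = u" "bipoly_eval R S \<phi> u v (bipoly_Z R) = v"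
    "c \<in> carrier R \<Longrightarrow> bipoly_eval R S \<phi> u v (bipoly_const R c) = \<phi> c"
proof -
  interpret U: UP_pre_univ_prop R S \<phi> "UP R" using UP_pre_univ_propI[OF R(1-3)] .
  interpret V: UP_pre_univ_prop "UP R" S "eval R S \<phi> u" "UP (UP R)"
    using UP_pre_univ_propI[OF cring_UP[OF R(1)] R(2) eval_in_ring_hom[OF R(1-4)]] .
  show "bipoly_eval R S \<phi> u v (bipoly_Y R) = u"
    unfolding bipoly_eval_def bipoly_Y_def
    using R(4,5) by (simp add: V.eval_const U.eval_monom1[simplified])
  show "bipoly_eval R S \<phi> u v (bipoly_Z R) = v"
    unfolding bipoly_eval_def bipoly_Z_def using V.eval_monom1[OF R(5)] by simp
  show "bipoly_eval R S \<phi> u v (bipoly_const R c) = \<phi> c" if "c \<in> carrier R"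
    unfolding bipoly_eval_def bipoly_const_def
    using that R(4,5) by (simp add: V.eval_const U.eval_const)
qed

text \<open>Take a nonzero coefficient \<open>B j\<close>, a polynomial in \<open>y\<close>. At most
  \<open>n\<close> values of \<open>y\<close> annihilate it, each contributing at most
  \<open>q\<close> zeros; for any other \<open>y\<close> the polynomial in \<open>z\<close> is
  nonzero and has at most \<open>n\<close> roots.\<close>

lemma card_bipoly_zeros_le:
  assumes "field R" and fin: "finite (carrier R)" and B: "B \<in> bipoly_box R n" "B \<noteq> \<zero>\<^bsub>bipoly_ring R\<^esub>"
  shows "card {s \<in> carrier R \<times> carrier R. bipoly_eval R R (\<lambda>c. c) (fst s) (snd s) B = \<zero>\<^bsub>R\<^esub>}
           \<le> 2 * n * card (carrier R)"
proof -
  interpret field R by fact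
  let ?C = "carrier R"
  let ?e = "\<lambda>y. eval R R (\<lambda>c. c) y"
  have Bc: "B \<in> carrier (bipoly_ring R)" using filtrationD(3)[OF filtration_bipoly_box B(1)] is_cring .
  then have Bj: "B j \<in> carrier (UP R)" for j using carrier_UP_iff by metis
  have B0: "B j = \<zero>\<^bsub>UP R\<^esub>" if "j > n" for j using B(1) that by (auto simp: bipoly_box_def up_box_def)
  have B00: "B j i = \<zero>\<^bsub>R\<^esub>" if "i > n" for i j
    using B(1) that by (cases "j \<le> n") (auto simp: bipoly_box_def up_box_def zero_UP)
  obtain j i where ij: "B j i \<noteq> \<zero>\<^bsub>R\<^esub>" using B(2) by (auto simp: zero_UP fun_eq_iff)
  define Y0 where "Y0 = {y \<in> ?C. ?e y (B j) = \<zero>\<^bsub>R\<^esub>}"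
  have Y0: "card Y0 \<le> n"
    unfolding Y0_def using ij
    by (intro card_roots_le[OF is_cring assms(1) fin ring_hom_ident Bj, of _ _ i] B00) auto
  define Zs where "Zs y = {z \<in> ?C. eval (UP R) R (?e y) z B = \<zero>\<^bsub>R\<^esub>}" for y
  have Zs: "card (Zs y) \<le> n" if "y \<in> ?C - Y0" for y
    unfolding Zs_def
  proof (rule card_roots_le[OF cring_UP[OF is_cring] assms(1) fin _ Bc])
    show "?e y \<in> ring_hom (UP R) R"
      using that by (intro eval_in_ring_hom is_cring ring_hom_ident) auto
    show "?e y (B j) \<noteq> \<zero>\<^bsub>R\<^esub>" using that by (auto simp: Y0_def)
  qed (rule B0)
  have finY: "finite Y0" "\<And>y. finite (Zs y)" using fin by (auto simp: Y0_def Zs_def)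
  have "card {s \<in> ?C \<times> ?C. bipoly_eval R R (\<lambda>c. c) (fst s) (snd s) B = \<zero>\<^bsub>R\<^esub>}
      \<le> card (Y0 \<times> ?C \<union> Sigma (?C - Y0) Zs)"
    using fin finY by (intro card_mono) (auto simp: Y0_def Zs_def bipoly_eval_def)
  also have "\<dots> \<le> card (Y0 \<times> ?C) + card (Sigma (?C - Y0) Zs)"
    by (rule card_Un_le)
  also have "card (Sigma (?C - Y0) Zs) = (\<Sum>y\<in>?C - Y0. card (Zs y))"
    using fin finY by simp
  also have "\<dots> \<le> (\<Sum>y\<in>?C - Y0. n)" by (intro sum_mono Zs)
  also have "\<dots> \<le> n * card ?C" using fin by (simp add: card_mono)
  also have "card (Y0 \<times> ?C) \<le> n * card ?C" using Y0 by (simp add: card_cartesian_product)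
  finally show ?thesis by simp
qed

section \<open>Algebraic dependence and the fibres of \<open>(F, G)\<close>\<close>

text \<open>By the pigeonhole principle two elements of \<open>D\<close> have the same image, and
  their difference stays in \<open>D\<close>.\<close>

lemma card_gt_imp_kernel:
  assumes "abelian_group G" "abelian_group H" "D \<subseteq> carrier G"
    and f: "\<And>x y. x \<in> carrier G \<Longrightarrow> y \<in> carrier G \<Longrightarrow> f (x \<oplus>\<^bsub>G\<^esub> y) = f x \<oplus>\<^bsub>H\<^esub> f y"
    and sub: "\<And>x y. x \<in> D \<Longrightarrow> y \<in> D \<Longrightarrow> x \<ominus>\<^bsub>G\<^esub> y \<in> D"
    and E: "f ` D \<subseteq> E" "E \<subseteq> carrier H" "finite E" "card E < card D"
  obtains x where "x \<in> D" "x \<noteq> \<zero>\<^bsub>G\<^esub>" "f x = \<zero>\<^bsub>H\<^esub>"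
proof -
  interpret G: abelian_group G by fact
  interpret H: abelian_group H by fact
  have "\<not> inj_on f D" using card_inj_on_le[OF _ E(1,3)] E(4) by auto
  then obtain x y where xy: "x \<in> D" "y \<in> D" "x \<noteq> y" "f x = f y" by (auto simp: inj_on_def)
  then have c: "x \<in> carrier G" "y \<in> carrier G" using assms(3) by auto
  have d: "x \<ominus>\<^bsub>G\<^esub> y \<in> D" using xy sub by blast
  then have dc: "x \<ominus>\<^bsub>G\<^esub> y \<in> carrier G" using assms(3) by auto
  have eq: "(x \<ominus>\<^bsub>G\<^esub> y) \<oplus>\<^bsub>G\<^esub> y = x"
    using c by (simp add: G.minus_eq G.a_assoc G.l_neg)
  have "f (x \<ominus>\<^bsub>G\<^esub> y) \<oplus>\<^bsub>H\<^esub> f y = f y" using f[OF dc c(2)] eq xy by simp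
  moreover have "f (x \<ominus>\<^bsub>G\<^esub> y) \<in> carrier H" "f y \<in> carrier H" using d xy E by auto
  ultimately have "f (x \<ominus>\<^bsub>G\<^esub> y) = \<zero>\<^bsub>H\<^esub>" using H.add.r_cancel_one by simp
  moreover have "x \<ominus>\<^bsub>G\<^esub> y \<noteq> \<zero>\<^bsub>G\<^esub>" using eq c xy by auto
  ultimately show ?thesis using that d by blast
qed

text \<open>Powers of \<open>F\<close> contribute degree at most \<open>N * m\<close> through the
  inner evaluation, powers of \<open>G\<close> at most \<open>N * n\<close> through the outer
  one.\<close>

lemma bipoly_compose_in_box:
  assumes R: "cring R" and F: "F \<in> bipoly_box R m" and G: "G \<in> bipoly_box R n"
    and H: "H \<in> bipoly_box R N"
  shows "bipoly_eval R (bipoly_ring R) (bipoly_const R) F G H \<in> bipoly_box R (N * m + N * n)"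
proof -
  note fil = filtration_bipoly_box[OF R]
  note Q = cring_UP[OF cring_UP[OF R]]
  have Fc: "F \<in> carrier (bipoly_ring R)" by (rule filtrationD(3)[OF fil F])
  have 1: "eval R (bipoly_ring R) (bipoly_const R) F p \<in> bipoly_box R (N * m)"
    if "p \<in> up_box R N (carrier R)" for p
    using eval_in_filtration[OF R Q bipoly_const_ring_hom[OF R] fil F subset_refl _ that, of 0]
      bipoly_const_in_box[OF R] by auto
  show ?thesis
    unfolding bipoly_eval_def
  proof (rule eval_in_filtration[OF cring_UP[OF R] Q _ fil G])
    show "eval R (bipoly_ring R) (bipoly_const R) F \<in> ring_hom (UP R) (bipoly_ring R)"
      by (rule eval_in_ring_hom[OF R Q bipoly_const_ring_hom[OF R] Fc])
    show "up_box R N (carrier R) \<subseteq> carrier (UP R)"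
      using up_box_subset cring.axioms(1)[OF R] by blast
    show "eval R (bipoly_ring R) (bipoly_const R) F ` up_box R N (carrier R) \<subseteq> bipoly_box R (N * m)"
      using 1 by auto
    show "H \<in> up_box (UP R) N (up_box R N (carrier R))"
      using H by (simp add: bipoly_box_def)
  qed
qed

text \<open>Any three elements of \<open>R[y,z]\<close> are algebraically dependent; here the
  dependence between \<open>F\<close>, \<open>G\<close> and \<open>W\<close> comes with explicit
  degree bounds. \<open>W\<close> will be \<open>y\<close> or \<open>z\<close>.\<close>

lemma exists_annihilator:
  assumes "field R" and fin: "finite (carrier R)"
    and F: "F \<in> bipoly_box R m" and G: "G \<in> bipoly_box R n" and W: "W \<in> bipoly_box R 1"
    and N: "N = (m + n + 1)\<^sup>2"
  obtains A where "A \<in> up_box (bipoly_ring R) N (bipoly_box R N)" "A \<noteq> \<zero>\<^bsub>UP (bipoly_ring R)\<^esub>"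
    "eval (bipoly_ring R) (bipoly_ring R) (bipoly_eval R (bipoly_ring R) (bipoly_const R) F G) W A
       = \<zero>\<^bsub>bipoly_ring R\<^esub>"
proof -
  interpret field R by fact
  let ?Q = "bipoly_ring R"
  let ?E = "bipoly_eval R ?Q (bipoly_const R) F G"
  let ?D = "up_box ?Q N (bipoly_box R N)"
  let ?L = "m + n + 1"
  note fil = filtration_bipoly_box[OF is_cring]
  note Q = cring_UP[OF cring_UP[OF is_cring]]
  note fil3 = filtrationD[OF filtration_UP[OF Q fil]]
  interpret UQ: cring "UP ?Q" using cring_UP[OF Q] .
  interpret Q: cring ?Q using Q .
  have c: "F \<in> carrier ?Q" "G \<in> carrier ?Q" "W \<in> carrier ?Q"
    using filtrationD(3)[OF fil] F G W by auto
  have E: "?E \<in> ring_hom ?Q ?Q"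
    by (rule bipoly_eval_ring_hom[OF is_cring Q bipoly_const_ring_hom[OF is_cring] c(1,2)])
  have \<Psi>: "eval ?Q ?Q ?E W \<in> ring_hom (UP ?Q) ?Q"
    by (rule eval_in_ring_hom[OF Q Q E c(3)])
  have q: "card (carrier R) > 1"
    using card_mono[OF fin, of "{\<zero>\<^bsub>R\<^esub>, \<one>\<^bsub>R\<^esub>}"] by simp
  \<comment> \<open>As \<open>N * ?L\<close> is the cube of \<open>?L\<close>, one extra
    \<open>?L\<close> absorbs the successor. After squaring, the exponent of \<open>q\<close> for
    the target box is at most \<open>(Suc N)^2 * N\<close>, below the exponent
    \<open>(Suc N)^2 * Suc N\<close> for \<open>?D\<close>.\<close>
  have "Suc (?L ^ 3) \<le> Suc N * ?L" by (simp add: N power2_eq_square power3_eq_cube)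
  then have "(Suc (?L ^ 3))\<^sup>2 \<le> (Suc N * ?L)\<^sup>2" by (rule power_mono) simp
  also have "\<dots> = (Suc N)\<^sup>2 * N" by (simp only: N power_mult_distrib)
  also have "\<dots> < (Suc N)\<^sup>2 * Suc N" by simp
  finally have size: "(Suc (?L ^ 3))\<^sup>2 < (Suc N)\<^sup>2 * Suc N" .
  show thesis
  proof (rule card_gt_imp_kernel[of "UP ?Q" ?Q ?D "eval ?Q ?Q ?E W" "bipoly_box R (?L ^ 3)"])
    show "card (bipoly_box R (?L ^ 3)) < card ?D"
      unfolding card_up_box card_bipoly_box power_mult[symmetric]
      using size q by (intro power_strict_increasing) auto
    have "eval ?Q ?Q ?E W A \<in> bipoly_box R (N * m + N * n + N * 1)" if "A \<in> ?D" for A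
      by (rule eval_in_filtration[OF Q Q E fil W _ _ that])
         (use filtrationD(3)[OF fil] bipoly_compose_in_box[OF is_cring F G] in auto)
    moreover have "N * m + N * n + N * 1 = ?L ^ 3"
      by (simp add: N power2_eq_square power3_eq_cube algebra_simps)
    ultimately show "eval ?Q ?Q ?E W ` ?D \<subseteq> bipoly_box R (?L ^ 3)" by auto
    show "x \<ominus>\<^bsub>UP ?Q\<^esub> y \<in> ?D" if "x \<in> ?D" "y \<in> ?D" for x y
      using that fil3(5,7) by (simp add: a_minus_def)
    show "?D \<subseteq> carrier (UP ?Q)" using fil3(3) by blast
    show "bipoly_box R (?L ^ 3) \<subseteq> carrier ?Q" using filtrationD(3)[OF fil] by blast
    show "finite (bipoly_box R (?L ^ 3))" using fin by (rule finite_bipoly_box)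
  qed (use ring_hom_add[OF \<Psi>] that UQ.abelian_group_axioms Q.abelian_group_axioms in auto)
qed

text \<open>\<open>Bad\<close> is the zero set of \<open>A k\<close> composed with
  \<open>(F, G)\<close>, for a nonzero coefficient \<open>A k\<close> of an annihilator of
  \<open>W\<close>. Off \<open>Bad\<close>, fixing the values of \<open>F\<close> and
  \<open>G\<close> leaves a nonzero polynomial of degree at most \<open>N\<close>, and
  \<open>W\<close> takes values among its roots on the fibre.\<close>

lemma generic_fibre_projection:
  fixes R (structure)
  assumes "field R" and fin: "finite (carrier R)"
    and F: "F \<in> bipoly_box R m" and G: "G \<in> bipoly_box R n" and W: "W \<in> bipoly_box R 1"
    and indep: "algebraically_independent R F G"
  defines "ev \<equiv> \<lambda>s. bipoly_eval R R (\<lambda>c. c) (fst s) (snd s)"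
  obtains Bad where "card Bad \<le> 2 * (m + n + 1) ^ 3 * card (carrier R)" "finite Bad"
    "\<And>s. s \<in> carrier R \<times> carrier R - Bad \<Longrightarrow>
      \<exists>V. finite V \<and> card V \<le> (m + n + 1)\<^sup>2 \<and>
        (\<forall>s' \<in> carrier R \<times> carrier R. ev s' F = ev s F \<longrightarrow> ev s' G = ev s G \<longrightarrow> ev s' W \<in> V)"
proof -
  interpret field R by fact
  define N where "N = (m + n + 1)\<^sup>2"
  let ?C = "carrier R"
  let ?Q = "bipoly_ring R"
  let ?E = "bipoly_eval R ?Q (bipoly_const R) F G"
  note fil = filtration_bipoly_box[OF is_cring]
  note Q = cring_UP[OF cring_UP[OF is_cring]]
  interpret Q: cring ?Q using Q .
  have c: "F \<in> carrier ?Q" "G \<in> carrier ?Q" "W \<in> carrier ?Q"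
    using filtrationD(3)[OF fil] F G W by auto
  have E: "?E \<in> ring_hom ?Q ?Q"
    by (rule bipoly_eval_ring_hom[OF is_cring Q bipoly_const_ring_hom[OF is_cring] c(1,2)])
  have ev: "ev s \<in> ring_hom ?Q R" if "s \<in> ?C \<times> ?C" for s
    unfolding ev_def using that
    by (intro bipoly_eval_ring_hom is_cring ring_hom_ident) auto
  have evE: "ev s (?E H) = bipoly_eval R R (\<lambda>c. c) (ev s F) (ev s G) H"
    if "s \<in> ?C \<times> ?C" "H \<in> carrier ?Q" for s H
  proof (rule hom_bipoly_eval[OF is_cring Q is_cring bipoly_const_ring_hom[OF is_cring] ev[OF that(1)] c(1,2) that(2)])
    fix c assume "c \<in> carrier R"
    then show "c = ev s (bipoly_const R c)"
      unfolding ev_def using that(1)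
      by (subst bipoly_eval_simps(3)[OF is_cring is_cring ring_hom_ident]) auto
  qed
  obtain A where A: "A \<in> up_box ?Q N (bipoly_box R N)" "A \<noteq> \<zero>\<^bsub>UP ?Q\<^esub>" "eval ?Q ?Q ?E W A = \<zero>\<^bsub>?Q\<^esub>"
    using exists_annihilator[OF assms(1) fin F G W N_def] .
  have Ac: "A \<in> carrier (UP ?Q)"
    using filtrationD(3)[OF filtration_UP[OF Q fil] A(1)] .
  then have Akc: "A i \<in> carrier ?Q" for i using carrier_UP_iff by metis
  have A0: "A i = \<zero>\<^bsub>?Q\<^esub>" if "i > N" for i using A(1) that by (auto simp: up_box_def)
  obtain k where k: "A k \<noteq> \<zero>\<^bsub>?Q\<^esub>" using A(2) by (auto simp: zero_UP[of ?Q] fun_eq_iff)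
  then have "A k \<in> bipoly_box R N" using A(1) A0[of k] by (auto simp: up_box_def not_less[symmetric])
  then have "?E (A k) \<in> bipoly_box R (N * m + N * n)"
    by (rule bipoly_compose_in_box[OF is_cring F G])
  then have box: "?E (A k) \<in> bipoly_box R ((m + n + 1) ^ 3)"
    by (rule filtrationD(1)[OF fil, rotated]) (simp add: N_def power2_eq_square power3_eq_cube algebra_simps)
  \<comment> \<open>Algebraic independence enters here: substituting \<open>(F, G)\<close> cannot
    annihilate the nonzero \<open>A k\<close>.\<close>
  have nz: "?E (A k) \<noteq> \<zero>\<^bsub>?Q\<^esub>" using indep k Akc unfolding algebraically_independent_def by blast
  define Bad where "Bad = {s \<in> ?C \<times> ?C. ev s (?E (A k)) = \<zero>}"
  show thesis
  proof (rule that[of Bad])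
    show "card Bad \<le> 2 * (m + n + 1) ^ 3 * card ?C"
      using card_bipoly_zeros_le[OF assms(1) fin box nz] by (simp add: Bad_def ev_def)
    show "finite Bad" using fin by (simp add: Bad_def)
    fix s assume s: "s \<in> ?C \<times> ?C - Bad"
    then have sC: "s \<in> ?C \<times> ?C" by simp
    define h where "h = bipoly_eval R R (\<lambda>c. c) (ev s F) (ev s G)"
    have h: "h \<in> ring_hom ?Q R"
      unfolding h_def
      by (intro bipoly_eval_ring_hom is_cring ring_hom_ident ring_hom_closed[OF ev[OF sC]] c)
    define V where "V = {w \<in> ?C. eval ?Q R h w A = \<zero>}"
    have "card V \<le> N"
      unfolding V_def
    proof (rule card_roots_le[OF Q assms(1) fin h Ac A0])
      show "h (A k) \<noteq> \<zero>" using s evE[OF sC Akc] by (simp add: Bad_def h_def)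
    qed
    moreover have "ev s' W \<in> V" if s': "s' \<in> ?C \<times> ?C" "ev s' F = ev s F" "ev s' G = ev s G" for s'
    proof -
      \<comment> \<open>The annihilator identity is specialised at \<open>s'\<close>. Its
        coefficients depend only on the values of \<open>F\<close> and \<open>G\<close>, which are
        the same as at \<open>s\<close>.\<close>
      have "\<zero> = ev s' (eval ?Q ?Q ?E W A)"
        using A(3) ring_hom_zero[OF ev[OF s'(1)] Q.ring_axioms ring_axioms] by simp
      also have "\<dots> = eval ?Q R (ev s' \<circ> ?E) (ev s' W) A"
        by (rule hom_eval[OF Q Q is_cring E ev[OF s'(1)] c(3) Ac])
      also have "\<dots> = eval ?Q R h (ev s' W) A"
        by (rule eval_cong[OF Ac]) (use evE[OF s'(1) Akc] s' in \<open>simp add: h_def\<close>)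
      finally show ?thesis
        using ring_hom_closed[OF ev[OF s'(1)] c(3)] by (simp add: V_def)
    qed
    moreover have "finite V" using fin by (simp add: V_def)
    ultimately show "\<exists>V. finite V \<and> card V \<le> (m + n + 1)\<^sup>2 \<and>
        (\<forall>s' \<in> ?C \<times> ?C. ev s' F = ev s F \<longrightarrow> ev s' G = ev s G \<longrightarrow> ev s' W \<in> V)"
      unfolding N_def by blast
  qed
qed

section \<open>Count of the missed values and conclusion\<close>

lemma card_complement_image3_le:
  fixes R (structure)
  assumes "field R" and fin: "finite (carrier R)" and a: "a \<in> carrier R"
    and F: "F \<in> carrier (bipoly_ring R)" and G: "G \<in> carrier (bipoly_ring R)"
    and indep: "algebraically_independent R F G"
    and X: "X \<subseteq> carrier R" and Y: "Y \<subseteq> carrier R" and Z: "Z \<subseteq> carrier R"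
  shows "card X * card Y * card Z * card (carrier R - image3 (P_eval R d a F G) X Y Z)
    \<le> 10 * (bipoly_deg R F + bipoly_deg R G + 1) ^ 4 * card (carrier R) ^ 3"
proof -
  interpret field R by fact
  let ?C = "carrier R"
  let ?T = "?C - image3 (P_eval R d a F G) X Y Z"
  define L where "L = bipoly_deg R F + bipoly_deg R G + 1"
  define q where "q = card ?C"
  let ?ev = "\<lambda>s. bipoly_eval R R (\<lambda>c. c) (fst s) (snd s)"
  have ev: "?ev s H \<in> ?C" if "s \<in> ?C \<times> ?C" "H \<in> carrier (bipoly_ring R)" for s H
    by (rule ring_hom_closed[OF bipoly_eval_ring_hom that(2)])
       (use that(1) in \<open>auto intro: is_cring ring_hom_ident\<close>)
  have evYZ: "?ev s (bipoly_Y R) = fst s" "?ev s (bipoly_Z R) = snd s" if "s \<in> ?C \<times> ?C" for s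
    using that by (auto intro!: bipoly_eval_simps(1,2) is_cring ring_hom_ident)
  note proj = generic_fibre_projection[OF assms(1) fin bipoly_in_box[OF F] bipoly_in_box[OF G] _ indep]
  obtain B1 where B1: "card B1 \<le> 2 * L ^ 3 * q" "finite B1"
    "\<And>s. s \<in> ?C \<times> ?C - B1 \<Longrightarrow> \<exists>V. finite V \<and> card V \<le> L\<^sup>2 \<and>
        (\<forall>s' \<in> ?C \<times> ?C. ?ev s' F = ?ev s F \<longrightarrow> ?ev s' G = ?ev s G \<longrightarrow> ?ev s' (bipoly_Y R) \<in> V)"
    using proj[OF bipoly_vars_in_box(1)[OF is_cring]] unfolding L_def q_def by blast
  obtain B2 where B2: "card B2 \<le> 2 * L ^ 3 * q" "finite B2"
    "\<And>s. s \<in> ?C \<times> ?C - B2 \<Longrightarrow> \<exists>V. finite V \<and> card V \<le> L\<^sup>2 \<and>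
        (\<forall>s' \<in> ?C \<times> ?C. ?ev s' F = ?ev s F \<longrightarrow> ?ev s' G = ?ev s G \<longrightarrow> ?ev s' (bipoly_Z R) \<in> V)"
    using proj[OF bipoly_vars_in_box(2)[OF is_cring]] unfolding L_def q_def by blast
  \<comment> \<open>\<open>B1\<close> and \<open>B2\<close> are the exceptional sets for the
    coordinates \<open>y\<close> and \<open>z\<close>; off both, each coordinate takes at most
    \<open>L^2\<close> values on a fibre, so a fibre has at most \<open>L^4\<close> points.\<close>
  define S where "S = Y \<times> Z - (B1 \<union> B2)"
  have SC: "S \<subseteq> ?C \<times> ?C" using Y Z by (auto simp: S_def)
  have finS: "finite S" using SC fin finite_subset by blast
  have "card X * card ?T * card S \<le> L ^ 4 * card ?C ^ 3"
  proof (rule card_missed_values_le[OF assms(1) fin finS, where g = "\<lambda>x. a \<otimes> x [^] d"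
        and \<phi> = "\<lambda>s. ?ev s F" and \<psi> = "\<lambda>s. ?ev s G"])
    fix s assume "s \<in> S"
    then have s: "s \<in> ?C \<times> ?C - B1" "s \<in> ?C \<times> ?C - B2" using SC by (auto simp: S_def)
    obtain V1 where V1: "finite V1" "card V1 \<le> L\<^sup>2"
      "\<And>s'. s' \<in> ?C \<times> ?C \<Longrightarrow> ?ev s' F = ?ev s F \<Longrightarrow> ?ev s' G = ?ev s G \<Longrightarrow> ?ev s' (bipoly_Y R) \<in> V1"
      using B1(3)[OF s(1)] by blast
    obtain V2 where V2: "finite V2" "card V2 \<le> L\<^sup>2"
      "\<And>s'. s' \<in> ?C \<times> ?C \<Longrightarrow> ?ev s' F = ?ev s F \<Longrightarrow> ?ev s' G = ?ev s G \<Longrightarrow> ?ev s' (bipoly_Z R) \<in> V2"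
      using B2(3)[OF s(2)] by blast
    have "{s' \<in> S. ?ev s' F = ?ev s F \<and> ?ev s' G = ?ev s G} \<subseteq> V1 \<times> V2"
    proof
      fix s' assume "s' \<in> {s' \<in> S. ?ev s' F = ?ev s F \<and> ?ev s' G = ?ev s G}"
      then have s': "s' \<in> ?C \<times> ?C" "?ev s' F = ?ev s F" "?ev s' G = ?ev s G" using SC by auto
      have "fst s' \<in> V1" "snd s' \<in> V2" using V1(3)[OF s'] V2(3)[OF s'] evYZ[OF s'(1)] by simp_all
      then show "s' \<in> V1 \<times> V2" by (simp add: mem_Times_iff)
    qed
    then have "card {s' \<in> S. ?ev s' F = ?ev s F \<and> ?ev s' G = ?ev s G} \<le> card (V1 \<times> V2)"
      using V1 V2 by (intro card_mono) auto
    also have "\<dots> \<le> L\<^sup>2 * L\<^sup>2" unfolding card_cartesian_product using V1(2) V2(2) by (rule mult_le_mono)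
    finally show "card {s' \<in> S. ?ev s' F = ?ev s F \<and> ?ev s' G = ?ev s G} \<le> L ^ 4"
      by (simp flip: power_add)
  next
    fix x s assume "x \<in> X" "s \<in> S"
    then have "x \<in> X" "fst s \<in> Y" "snd s \<in> Z" by (auto simp: S_def)
    then have "P_eval R d a F G x (fst s) (snd s) \<in> image3 (P_eval R d a F G) X Y Z"
      unfolding image3_def by blast
    then show "a \<otimes> x [^] d \<oplus> ?ev s F \<otimes> x \<oplus> ?ev s G \<notin> ?T" by (simp add: P_eval_def)
  qed (use ev F G SC a X in auto)
  then have main: "card X * card ?T * card S \<le> L ^ 4 * q ^ 3" by (simp add: q_def)
  have "card (Y \<times> Z) \<le> card (S \<union> (B1 \<union> B2))"
    using finS B1 B2 by (intro card_mono) (auto simp: S_def)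
  also have "\<dots> \<le> card S + (card B1 + card B2)"
    by (meson card_Un_le add_left_mono order.trans)
  finally have YZ: "card Y * card Z \<le> card S + 4 * L ^ 3 * q"
    using B1(1) B2(1) by (simp add: card_cartesian_product)
  \<comment> \<open>If \<open>card Y * card Z\<close> is at most \<open>8 * L^3 * q\<close>, the
    trivial bounds by \<open>q\<close> suffice. Otherwise the at most \<open>4 * L^3 * q\<close>
    removed points are fewer than half of \<open>Y \<times> Z\<close>, which costs a factor 2 in
    \<open>main\<close>. The constant 10 covers both cases.\<close>
  have "card X * card Y * card Z * card ?T \<le> 10 * L ^ 4 * q ^ 3"
  proof (cases "card Y * card Z \<le> 8 * L ^ 3 * q")
    case True
    have "card X \<le> q" "card ?T \<le> q" using X fin by (auto simp: q_def intro: card_mono)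
    then have "card X * (card Y * card Z) * card ?T \<le> q * (8 * L ^ 3 * q) * q"
      by (rule mult_le_mono[OF mult_le_mono[OF _ True]])
    also have "\<dots> = 8 * L ^ 3 * q ^ 3" by (simp add: power3_eq_cube)
    also have "\<dots> \<le> 10 * L ^ 4 * q ^ 3"
      by (intro mult_le_mono1 mult_le_mono[of 8 10] power_increasing) (auto simp: L_def)
    finally show ?thesis by (simp add: mult.assoc)
  next
    case False
    then have "card Y * card Z \<le> 2 * card S" using YZ by simp
    then have "card X * card ?T * (card Y * card Z) \<le> card X * card ?T * (2 * card S)"
      by (rule mult_le_mono2)
    also have "\<dots> \<le> 2 * (L ^ 4 * q ^ 3)" using main by simp
    also have "\<dots> \<le> 10 * L ^ 4 * q ^ 3" by simp
    finally show ?thesis by (simp add: mult_ac)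
  qed
  then show ?thesis by (simp add: L_def q_def)
qed

theorem theorem1p6:
  shows "\<exists>K :: nat \<Rightarrow> nat \<Rightarrow> real. (\<forall>m n. K m n > 0) \<and>
    (\<forall>d :: nat. \<exists>C :: real. C > 0 \<and>
      (\<forall>(q :: nat) (R :: 'a ring) a F G X Y Z.
        primepow q \<longrightarrow> field R \<longrightarrow> finite (carrier R) \<longrightarrow> card (carrier R) = q \<longrightarrow>
        a \<in> carrier R \<longrightarrow>
        F \<in> carrier (bipoly_ring R) \<longrightarrow> G \<in> carrier (bipoly_ring R) \<longrightarrow>
        algebraically_independent R F G \<longrightarrow>
        X \<subseteq> carrier R \<longrightarrow> Y \<subseteq> carrier R \<longrightarrow> Z \<subseteq> carrier R \<longrightarrow>
        real (card X) \<ge> C * real q powr (2 / 3) \<longrightarrow>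
        real (card Y) \<ge> C * real q powr (2 / 3) \<longrightarrow>
        real (card Z) \<ge> C * real q powr (2 / 3) \<longrightarrow>
        \<bar>real (card (image3 (P_eval R d a F G) X Y Z)) - real q\<bar>
          \<le> K (bipoly_deg R F) (bipoly_deg R G)
              * (real q ^ 3 / (real (card X) * real (card Y) * real (card Z)))))"
\<comment> \<open>The witness for \<open>K\<close> is the constant of the bound on missed values,
  chosen before \<open>d\<close> and the field.\<close>
proof (rule exI[of _ "\<lambda>m n. 10 * real (m + n + 1) ^ 4"], intro conjI allI)
  fix d :: nat
  show "\<exists>C :: real. C > 0 \<and>
      (\<forall>(q :: nat) (R :: 'a ring) a F G X Y Z.
        primepow q \<longrightarrow> field R \<longrightarrow> finite (carrier R) \<longrightarrow> card (carrier R) = q \<longrightarrow>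
        a \<in> carrier R \<longrightarrow>
        F \<in> carrier (bipoly_ring R) \<longrightarrow> G \<in> carrier (bipoly_ring R) \<longrightarrow>
        algebraically_independent R F G \<longrightarrow>
        X \<subseteq> carrier R \<longrightarrow> Y \<subseteq> carrier R \<longrightarrow> Z \<subseteq> carrier R \<longrightarrow>
        real (card X) \<ge> C * real q powr (2 / 3) \<longrightarrow>
        real (card Y) \<ge> C * real q powr (2 / 3) \<longrightarrow>
        real (card Z) \<ge> C * real q powr (2 / 3) \<longrightarrow>
        \<bar>real (card (image3 (P_eval R d a F G) X Y Z)) - real q\<bar>
          \<le> 10 * real (bipoly_deg R F + bipoly_deg R G + 1) ^ 4
              * (real q ^ 3 / (real (card X) * real (card Y) * real (card Z))))"
  proof (rule exI[of _ 1], intro conjI allI impI)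
    fix q and R :: "'a ring" and a F G X Y Z
    assume q: "primepow q" and R: "field R" "finite (carrier R)" "card (carrier R) = q"
      and a: "a \<in> carrier R" and F: "F \<in> carrier (bipoly_ring R)" and G: "G \<in> carrier (bipoly_ring R)"
      and indep: "algebraically_independent R F G"
      and sub: "X \<subseteq> carrier R" "Y \<subseteq> carrier R" "Z \<subseteq> carrier R"
      and large: "real (card X) \<ge> 1 * real q powr (2 / 3)" "real (card Y) \<ge> 1 * real q powr (2 / 3)"
        "real (card Z) \<ge> 1 * real q powr (2 / 3)"
    interpret field R by fact
    let ?I = "image3 (P_eval R d a F G) X Y Z"
    \<comment> \<open>With \<open>C = 1\<close> the size bounds make all three cardinalities
      positive, which permits the final division.\<close>
    have "real q powr (2 / 3) > 0" using primepow_gt_0_nat[OF q] by simp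
    then have pos: "real (card X) * real (card Y) * real (card Z) > 0"
      using large by (intro mult_pos_pos) linarith+
    have I: "?I \<subseteq> carrier R"
    proof
      fix t assume "t \<in> ?I"
      then obtain x y z where t: "t = P_eval R d a F G x y z" "x \<in> X" "y \<in> Y" "z \<in> Z"
        by (auto simp: image3_def)
      then have "bipoly_eval R R (\<lambda>c. c) y z \<in> ring_hom (bipoly_ring R) R"
        using sub by (intro bipoly_eval_ring_hom is_cring ring_hom_ident) auto
      from ring_hom_closed[OF this F] ring_hom_closed[OF this G] show "t \<in> carrier R"
        using t a sub by (auto simp: P_eval_def)
    qed
    \<comment> \<open>The image lies in the field, so its distance from \<open>q\<close> is exactly
      the number of missed values.\<close>
    then have "card (carrier R - ?I) = q - card ?I" "card ?I \<le> q"
      using R by (auto simp: card_Diff_subset finite_subset card_mono)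
    then have "\<bar>real (card ?I) - real q\<bar> = real (card (carrier R - ?I))" by (simp add: of_nat_diff)
    moreover have "real (card X * card Y * card Z * card (carrier R - ?I))
        \<le> real (10 * (bipoly_deg R F + bipoly_deg R G + 1) ^ 4 * card (carrier R) ^ 3)"
      unfolding of_nat_le_iff by (rule card_complement_image3_le[OF R(1,2) a F G indep sub])
    ultimately have "\<bar>real (card ?I) - real q\<bar> * (real (card X) * real (card Y) * real (card Z))
        \<le> 10 * real (bipoly_deg R F + bipoly_deg R G + 1) ^ 4 * real q ^ 3"
      using R(3) by (simp only: of_nat_mult of_nat_power of_nat_numeral mult_ac)
    then show "\<bar>real (card ?I) - real q\<bar> \<le> 10 * real (bipoly_deg R F + bipoly_deg R G + 1) ^ 4
        * (real q ^ 3 / (real (card X) * real (card Y) * real (card Z)))"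
      using pos by (simp only: pos_le_divide_eq times_divide_eq_right)
  qed simp
qed simp

end
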